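(* Let $\kappa$ be a multiplicity function on the Young graph, let $M$ be a $\kappa$-central probability measure on $\mathrm{Tab}$ with associated $\kappa$-harmonic function $\varphi$, and let $(i,j)$ be a box which is completely reachable with respect to $M$. Then $$\sum_{\mu\in H'(i,j)}\dim_{\kappa}\mu\cdot\kappa\big(\mu,\mu\cup\{(i,j)\}\big)\cdot\varphi\big(\mu\cup\{(i,j)\}\big)=1 .$$
   Context: Young graph: its vertices are all Young diagrams (including the empty diagram $\varnothing$); write $\mu\nearrow\lambda$ if $\lambda$ is obtained from $\mu$ by adding one box; these pairs are the edges. A box $(i,j)$ lies in row $i$ and column $j$. A finite path is $\sigma=(\varnothing\nearrow\sigma^1\nearrow\dots\nearrow\sigma^n)$; an infinite path is $\tau=(\varnothing\nearrow\tau^1\nearrow\tau^2\nearrow\dots)$ (equivalently an infinite standard Young tableau, $\tau^n$ being the set of boxes with label $\le n$), and we set $\tau^0=\varnothing$. $\mathrm{Tab}$ is the set of infinite paths with the projective-limit topology; for a finite path $\sigma$ of length $n$, the cylinder set $\mathrm{Cyl}(\sigma)$ is the set of $\tau\in\mathrm{Tab}$ with $\tau^m=\sigma^m$ for $m\le n$. A multiplicity function is a strictly positive function $\kappa$ on edges; for a finite path put $\kappa(\sigma)=\prod_{m=1}^n\kappa(\sigma^{m-1},\sigma^m)$ (empty product $=1$), and $\dim_\kappa\lambda=\sum\kappa(\sigma)$ over all finite paths from $\varnothing$ to $\lambda$. A Borel probability measure $M$ on $\mathrm{Tab}$ is $\kappa$-central if there is a function $\varphi$ on Young diagrams with $M(\mathrm{Cyl}(\sigma))=\kappa(\sigma)\varphi(\lambda)$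 for every finite path $\sigma$ ending at $\lambda$; $\varphi$ is the associated $\kappa$-harmonic function. A box $(i,j)$ is completely reachable for $M$ if for $M$-almost every $\tau$ the box belongs to $\bigcup_n\tau^n$. $H'(i,j)$ denotes the set of finite Young diagrams $\mu$ not containing $(i,j)$ such that $\mu\cup\{(i,j)\}$ is a Young diagram. *)

theory Defs
  imports "HOL-Probability.Probability"
begin

text \<open>Rows and columns are numbered from 0, so that every pair of naturals is a box.\<close>

type_synonym box = "nat \<times> nat"
type_synonym diagram = "box set"

definition young_diagram :: "diagram \<Rightarrow> bool" where
  "young_diagram \<nu> \<longleftrightarrow> finite \<nu> \<and>
     (\<forall>i j i' j'. (i, j) \<in> \<nu> \<longrightarrow> i' \<le> i \<longrightarrow> j' \<le> j \<longrightarrow> (i', j') \<in> \<nu>)"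

definition young_edge :: "diagram \<Rightarrow> diagram \<Rightarrow> bool" (infix "\<nearrow>" 50) where
  "\<mu> \<nearrow> \<nu> \<longleftrightarrow> young_diagram \<mu> \<and> young_diagram \<nu> \<and> (\<exists>b. b \<notin> \<mu> \<and> \<nu> = \<mu> \<union> {b})"

text \<open>A finite path of length \<open>n\<close> is the list of its \<open>n + 1\<close> vertices, the initial empty
  diagram included, so that \<open>\<sigma> ! m\<close> is its \<open>m\<close>-th vertex.\<close>

definition finite_path :: "diagram list \<Rightarrow> bool" where
  "finite_path \<sigma> \<longleftrightarrow> \<sigma> \<noteq> [] \<and> \<sigma> ! 0 = {} \<and> (\<forall>m. Suc m < length \<sigma> \<longrightarrow> \<sigma> ! m \<nearrow> \<sigma> ! Suc m)"

definition paths_of_length :: "nat \<Rightarrow> diagram list set" where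
  "paths_of_length n = {\<sigma>. finite_path \<sigma> \<and> length \<sigma> = Suc n}"

definition paths_to :: "diagram \<Rightarrow> diagram list set" where
  "paths_to \<nu> = {\<sigma>. finite_path \<sigma> \<and> last \<sigma> = \<nu>}"

definition Tab :: "(nat \<Rightarrow> diagram) set" where
  "Tab = {\<tau>. \<tau> 0 = {} \<and> (\<forall>n. \<tau> n \<nearrow> \<tau> (Suc n))}"

definition truncate_path :: "(nat \<Rightarrow> diagram) \<Rightarrow> nat \<Rightarrow> diagram list" where
  "truncate_path \<tau> n = map \<tau> [0..<Suc n]"

text \<open>The projective limit of the discrete spaces \<open>paths_of_length n\<close> carries the topology
  induced from their product; an infinite path corresponds to the sequence of its truncations.\<close>

definition tab_topology :: "(nat \<Rightarrow> diagram) topology" where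
  "tab_topology = pullback_topology Tab truncate_path
     (product_topology (\<lambda>n. discrete_topology (paths_of_length n)) UNIV)"

definition tab_borel :: "(nat \<Rightarrow> diagram) measure" where
  "tab_borel = sigma Tab {U. openin tab_topology U}"

definition Cyl :: "diagram list \<Rightarrow> (nat \<Rightarrow> diagram) set" where
  "Cyl \<sigma> = {\<tau> \<in> Tab. \<forall>m < length \<sigma>. \<tau> m = \<sigma> ! m}"

definition multiplicity_function :: "(diagram \<Rightarrow> diagram \<Rightarrow> real) \<Rightarrow> bool" where
  "multiplicity_function \<kappa> \<longleftrightarrow> (\<forall>\<mu> \<nu>. \<mu> \<nearrow> \<nu> \<longrightarrow> \<kappa> \<mu> \<nu> > 0)"

definition path_weight :: "(diagram \<Rightarrow> diagram \<Rightarrow> real) \<Rightarrow> diagram list \<Rightarrow> real" where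
  "path_weight \<kappa> \<sigma> = (\<Prod>m = 1..length \<sigma> - 1. \<kappa> (\<sigma> ! (m - 1)) (\<sigma> ! m))"

definition kappa_dim :: "(diagram \<Rightarrow> diagram \<Rightarrow> real) \<Rightarrow> diagram \<Rightarrow> real" where
  "kappa_dim \<kappa> \<nu> = (\<Sum>\<sigma> \<in> paths_to \<nu>. path_weight \<kappa> \<sigma>)"

definition associated_harmonic ::
  "(diagram \<Rightarrow> diagram \<Rightarrow> real) \<Rightarrow> (nat \<Rightarrow> diagram) measure \<Rightarrow> (diagram \<Rightarrow> real) \<Rightarrow> bool" where
  "associated_harmonic \<kappa> M \<phi> \<longleftrightarrow>
     (\<forall>\<sigma>. finite_path \<sigma> \<longrightarrow> measure M (Cyl \<sigma>) = path_weight \<kappa> \<sigma> * \<phi> (last \<sigma>))"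

definition central_measure ::
  "(diagram \<Rightarrow> diagram \<Rightarrow> real) \<Rightarrow> (nat \<Rightarrow> diagram) measure \<Rightarrow> bool" where
  "central_measure \<kappa> M \<longleftrightarrow>
     prob_space M \<and> sets M = sets tab_borel \<and> (\<exists>\<phi>. associated_harmonic \<kappa> M \<phi>)"

definition completely_reachable :: "(nat \<Rightarrow> diagram) measure \<Rightarrow> box \<Rightarrow> bool" where
  "completely_reachable M b \<longleftrightarrow> (AE \<tau> in M. b \<in> (\<Union>n. \<tau> n))"

definition H' :: "nat \<Rightarrow> nat \<Rightarrow> diagram set" where
  "H' i j = {\<mu>. young_diagram \<mu> \<and> (i, j) \<notin> \<mu> \<and> young_diagram (\<mu> \<union> {(i, j)})}"

text \<open>The sum defining \<open>kappa_dim\<close> is finite.\<close>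

lemma finite_path_nth:
  assumes "finite_path \<sigma>" "m < length \<sigma>"
  shows "finite (\<sigma> ! m) \<and> card (\<sigma> ! m) = m"
  using assms(2)
proof (induction m)
  case 0
  then show ?case using assms(1) by (simp add: finite_path_def)
next
  case (Suc m)
  then have "\<sigma> ! m \<nearrow> \<sigma> ! Suc m" using assms(1) by (simp add: finite_path_def)
  then show ?case using Suc by (auto simp: young_edge_def)
qed

lemma finite_path_mono:
  assumes "finite_path \<sigma>" "k \<le> m" "m < length \<sigma>"
  shows "\<sigma> ! k \<subseteq> \<sigma> ! m"
  using assms(2,3)
proof (induction m rule: dec_induct)
  case (step m)
  then have "\<sigma> ! m \<nearrow> \<sigma> ! Suc m" using assms(1) by (simp add: finite_path_def)
  then show ?case using step by (auto simp: young_edge_def)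
qed simp

lemma finite_paths_to:
  assumes "finite \<nu>"
  shows "finite (paths_to \<nu>)"
proof (rule finite_subset)
  show "paths_to \<nu> \<subseteq> {\<sigma>. set \<sigma> \<subseteq> Pow \<nu> \<and> length \<sigma> = Suc (card \<nu>)}"
  proof
    fix \<sigma> assume "\<sigma> \<in> paths_to \<nu>"
    then have p: "finite_path \<sigma>" and l: "last \<sigma> = \<nu>" by (auto simp: paths_to_def)
    from p have ne: "\<sigma> \<noteq> []" by (simp add: finite_path_def)
    with l have nth: "\<sigma> ! (length \<sigma> - 1) = \<nu>" by (simp add: last_conv_nth)
    from ne have lt: "length \<sigma> - 1 < length \<sigma>" by simp
    from finite_path_nth[OF p lt] nth have "card \<nu> = length \<sigma> - 1" by simp
    moreover have "\<sigma> ! k \<subseteq> \<nu>" if "k < length \<sigma>" for k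
      using finite_path_mono[OF p _ lt, of k] that nth by simp
    ultimately show "\<sigma> \<in> {\<sigma>. set \<sigma> \<subseteq> Pow \<nu> \<and> length \<sigma> = Suc (card \<nu>)}"
      using ne by (fastforce simp: in_set_conv_nth)
  qed
  show "finite {\<sigma>. set \<sigma> \<subseteq> Pow \<nu> \<and> length \<sigma> = Suc (card \<nu>)}"
    using assms by (intro finite_lists_length_eq) simp
qed

lemma truncate_path_in: "\<tau> \<in> Tab \<Longrightarrow> truncate_path \<tau> n \<in> paths_of_length n"
  unfolding truncate_path_def paths_of_length_def finite_path_def Tab_def
  by (auto simp: nth_append simp del: upt_Suc)

lemma topspace_tab_topology: "topspace tab_topology = Tab"
  using truncate_path_in
  by (auto simp: tab_topology_def topspace_pullback_topology PiE_UNIV_domain)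

lemma openin_Cyl:
  assumes "finite_path \<sigma>"
  shows "openin tab_topology (Cyl \<sigma>)"
proof -
  define n where "n = length \<sigma> - 1"
  have len: "length \<sigma> = Suc n" using assms by (cases \<sigma>) (auto simp: n_def finite_path_def)
  let ?T = "product_topology (\<lambda>n. discrete_topology (paths_of_length n)) UNIV"
  let ?U = "{f \<in> topspace ?T. f n \<in> {\<sigma>}}"
  have "\<sigma> \<in> paths_of_length n" using assms len by (simp add: paths_of_length_def)
  then have "openin ?T ?U"
    by (intro openin_continuous_map_preimage[OF continuous_map_product_projection]) auto
  moreover have "truncate_path \<tau> n = \<sigma> \<longleftrightarrow> (\<forall>m < length \<sigma>. \<tau> m = \<sigma> ! m)" for \<tau>
    by (auto simp: list_eq_iff_nth_eq truncate_path_def len simp del: upt_Suc)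
  then have "Cyl \<sigma> = truncate_path -` ?U \<inter> Tab"
    using truncate_path_in by (auto simp: Cyl_def PiE_UNIV_domain)
  ultimately show ?thesis
    unfolding tab_topology_def openin_pullback_topology by blast
qed

end

theory Submission
  imports Defs
begin

text \<open>Almost every \<open>\<tau>\<close> adds the box \<open>(i, j)\<close> at exactly one step \<open>\<mu> \<nearrow> \<mu> \<union> {(i, j)}\<close>, and then
  \<open>\<mu> \<in> H' i j\<close>. The event that a given edge \<open>\<mu> \<nearrow> \<nu>\<close> is crossed is a finite disjoint union of
  cylinders, one for each path from the empty diagram to \<open>\<mu>\<close>, so by centrality its probability is
  \<open>dim \<mu> \<cdot> \<kappa>(\<mu>, \<nu>) \<cdot> \<phi>(\<nu>)\<close>. Countable additivity gives the result.\<close>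

text \<open>The step \<open>n\<close> can stay existential: \<open>\<tau> n\<close> has exactly
  \<open>n\<close> boxes, so only \<open>n = card \<mu>\<close> can occur.\<close>

definition crossing :: "diagram \<Rightarrow> diagram \<Rightarrow> (nat \<Rightarrow> diagram) set" where
  "crossing \<mu> \<nu> = {\<tau> \<in> Tab. \<exists>n. \<tau> n = \<mu> \<and> \<tau> (Suc n) = \<nu>}"

lemma Tab_mono: "\<tau> \<in> Tab \<Longrightarrow> mono \<tau>"
  by (intro mono_iff_le_Suc[THEN iffD2]) (auto simp: Tab_def young_edge_def)

text \<open>Each edge adds one box, so the length is fixed by the endpoint. This is what makes
  cylinders of distinct paths to one diagram disjoint.\<close>

lemma length_paths_to:
  assumes "\<sigma> \<in> paths_to \<nu>"
  shows "length \<sigma> = Suc (card \<nu>)"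
proof -
  from assms have p: "finite_path \<sigma>" "last \<sigma> = \<nu>" "\<sigma> \<noteq> []"
    by (auto simp: paths_to_def finite_path_def)
  then show ?thesis
    using finite_path_nth[OF p(1), of "length \<sigma> - 1"] by (simp add: last_conv_nth)
qed

lemma finite_path_snoc:
  assumes "finite_path \<sigma>" "last \<sigma> \<nearrow> \<nu>"
  shows "finite_path (\<sigma> @ [\<nu>])"
  unfolding finite_path_def
proof (intro conjI allI impI)
  have ne: "\<sigma> \<noteq> []" using assms(1) by (simp add: finite_path_def)
  then show "(\<sigma> @ [\<nu>]) ! 0 = {}" using assms(1) by (simp add: finite_path_def nth_append)
  fix m assume "Suc m < length (\<sigma> @ [\<nu>])"
  then consider "Suc m < length \<sigma>" | "m = length \<sigma> - 1" "Suc m = length \<sigma>" by fastforce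
  then show "(\<sigma> @ [\<nu>]) ! m \<nearrow> (\<sigma> @ [\<nu>]) ! Suc m"
  proof cases
    case 1
    then show ?thesis using assms(1) by (simp add: finite_path_def nth_append)
  next
    case 2
    then show ?thesis using assms(2) ne by (simp add: nth_append last_conv_nth)
  qed
qed simp

lemma path_weight_snoc:
  assumes "\<sigma> \<noteq> []"
  shows "path_weight \<kappa> (\<sigma> @ [\<nu>]) = path_weight \<kappa> \<sigma> * \<kappa> (last \<sigma>) \<nu>"
proof -
  obtain n where n: "length \<sigma> = Suc n" using assms by (cases \<sigma>) auto
  \<comment> \<open>Appending a vertex leaves the old factors unchanged; the only new factor, at
    index \<open>Suc n\<close>, is the weight of the last edge.\<close>
  have "(\<Prod>m = 1..n. \<kappa> ((\<sigma> @ [\<nu>]) ! (m - 1)) ((\<sigma> @ [\<nu>]) ! m))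
      = (\<Prod>m = 1..n. \<kappa> (\<sigma> ! (m - 1)) (\<sigma> ! m))"
    using n by (intro prod.cong) (auto simp: nth_append)
  then show ?thesis
    using n assms by (simp add: path_weight_def nth_append last_conv_nth)
qed

text \<open>Truncating \<open>\<tau>\<close> just before the crossing yields the path to
  \<open>\<mu>\<close> that selects its cylinder; conversely the last two vertices of
  \<open>\<sigma> @ [\<nu>]\<close> exhibit the crossing.\<close>

lemma crossing_eq_Union_Cyl:
  "crossing \<mu> \<nu> = (\<Union>\<sigma> \<in> paths_to \<mu>. Cyl (\<sigma> @ [\<nu>]))"
proof (intro equalityI subsetI)
  fix \<tau> assume "\<tau> \<in> crossing \<mu> \<nu>"
  then obtain n where t: "\<tau> \<in> Tab" "\<tau> n = \<mu>" "\<tau> (Suc n) = \<nu>"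
    by (auto simp: crossing_def)
  have "truncate_path \<tau> n \<in> paths_to \<mu>"
    using truncate_path_in[OF t(1), of n] t(2)
    by (simp add: paths_of_length_def paths_to_def truncate_path_def)
  moreover have "truncate_path \<tau> n @ [\<nu>] = truncate_path \<tau> (Suc n)"
    using t(3) by (simp add: truncate_path_def)
  then have "\<tau> \<in> Cyl (truncate_path \<tau> n @ [\<nu>])"
    using t(1) by (simp add: Cyl_def truncate_path_def del: upt_Suc)
  ultimately show "\<tau> \<in> (\<Union>\<sigma> \<in> paths_to \<mu>. Cyl (\<sigma> @ [\<nu>]))" by blast
next
  fix \<tau> assume "\<tau> \<in> (\<Union>\<sigma> \<in> paths_to \<mu>. Cyl (\<sigma> @ [\<nu>]))"
  then obtain \<sigma> where s: "finite_path \<sigma>" "last \<sigma> = \<mu>" and t: "\<tau> \<in> Tab"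
    and nth: "\<And>m. m < Suc (length \<sigma>) \<Longrightarrow> \<tau> m = (\<sigma> @ [\<nu>]) ! m"
    by (auto simp: Cyl_def paths_to_def)
  obtain n where n: "length \<sigma> = Suc n"
    using s(1) by (cases \<sigma>) (auto simp: finite_path_def)
  then have "\<sigma> \<noteq> []" by auto
  then have "\<tau> n = \<mu>" "\<tau> (Suc n) = \<nu>"
    using nth[of n] nth[of "Suc n"] n s(2) by (simp_all add: nth_append last_conv_nth)
  then show "\<tau> \<in> crossing \<mu> \<nu>" using t by (auto simp: crossing_def)
qed

text \<open>Equal length is essential: the cylinder of a path is contained in the cylinder of each
  of its prefixes.\<close>

lemma disjoint_Cyl:
  assumes "length \<sigma> = length \<sigma>'" "\<sigma> \<noteq> \<sigma>'"
  shows "Cyl \<sigma> \<inter> Cyl \<sigma>' = {}"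
  using assms by (auto simp: Cyl_def list_eq_iff_nth_eq)

text \<open>Side condition under which \<open>sets tab_borel\<close> is the sigma-algebra generated
  by the open sets.\<close>

lemma openin_tab_subset: "{U. openin tab_topology U} \<subseteq> Pow Tab"
  using openin_subset topspace_tab_topology by blast

lemma space_tab_borel: "space tab_borel = Tab"
  unfolding tab_borel_def using openin_tab_subset by (rule space_measure_of)

lemma Cyl_in_sets:
  assumes "sets M = sets tab_borel" "finite_path \<sigma>"
  shows "Cyl \<sigma> \<in> sets M"
  using assms openin_Cyl[OF assms(2)] openin_tab_subset by (auto simp: tab_borel_def)

lemma
  assumes "prob_space M" "sets M = sets tab_borel" "associated_harmonic \<kappa> M \<phi>" "\<mu> \<nearrow> \<nu>"
  shows crossing_in_sets: "crossing \<mu> \<nu> \<in> sets M"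
    and measure_crossing: "measure M (crossing \<mu> \<nu>) = kappa_dim \<kappa> \<mu> * \<kappa> \<mu> \<nu> * \<phi> \<nu>"
proof -
  interpret prob_space M by fact
  have fin: "finite (paths_to \<mu>)"
    using assms(4) by (intro finite_paths_to) (simp add: young_edge_def young_diagram_def)
  have path: "finite_path (\<sigma> @ [\<nu>])" if "\<sigma> \<in> paths_to \<mu>" for \<sigma>
    using that assms(4) by (intro finite_path_snoc) (auto simp: paths_to_def)
  then have meas: "Cyl (\<sigma> @ [\<nu>]) \<in> sets M" if "\<sigma> \<in> paths_to \<mu>" for \<sigma>
    using that assms(2) by (intro Cyl_in_sets)
  then show "crossing \<mu> \<nu> \<in> sets M"
    using fin by (auto simp: crossing_eq_Union_Cyl)
  have "disjoint_family_on (\<lambda>\<sigma>. Cyl (\<sigma> @ [\<nu>])) (paths_to \<mu>)"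
    unfolding disjoint_family_on_def by (intro ballI impI disjoint_Cyl) (auto simp: length_paths_to)
  then have "measure M (crossing \<mu> \<nu>) = (\<Sum>\<sigma> \<in> paths_to \<mu>. measure M (Cyl (\<sigma> @ [\<nu>])))"
    unfolding crossing_eq_Union_Cyl using fin meas by (intro finite_measure_finite_Union) auto
  \<comment> \<open>By centrality the factor \<open>\<kappa> \<mu> \<nu> * \<phi> \<nu>\<close> is
    the same for all paths to \<open>\<mu>\<close>, so summing the remaining weights gives
    \<open>kappa_dim\<close>.\<close>
  also have "\<dots> = (\<Sum>\<sigma> \<in> paths_to \<mu>. path_weight \<kappa> \<sigma> * (\<kappa> \<mu> \<nu> * \<phi> \<nu>))"
  proof (intro sum.cong refl)
    fix \<sigma> assume s: "\<sigma> \<in> paths_to \<mu>"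
    then have "\<sigma> \<noteq> []" "last \<sigma> = \<mu>" by (auto simp: paths_to_def finite_path_def)
    then show "measure M (Cyl (\<sigma> @ [\<nu>])) = path_weight \<kappa> \<sigma> * (\<kappa> \<mu> \<nu> * \<phi> \<nu>)"
      using assms(3) path[OF s] by (simp add: associated_harmonic_def path_weight_snoc)
  qed
  also have "\<dots> = kappa_dim \<kappa> \<mu> * \<kappa> \<mu> \<nu> * \<phi> \<nu>"
    by (simp add: kappa_dim_def sum_distrib_right mult.assoc)
  finally show "measure M (crossing \<mu> \<nu>) = kappa_dim \<kappa> \<mu> * \<kappa> \<mu> \<nu> * \<phi> \<nu>" .
qed

text \<open>Paths increase, so a box once added is never removed and cannot be added a second
  time.\<close>

lemma disjoint_crossing:
  assumes "b \<notin> \<mu>" "b \<notin> \<mu>'" "b \<in> \<nu>" "b \<in> \<nu>'" "\<mu> \<noteq> \<mu>'"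
  shows "crossing \<mu> \<nu> \<inter> crossing \<mu>' \<nu>' = {}"
proof (rule ccontr)
  assume "crossing \<mu> \<nu> \<inter> crossing \<mu>' \<nu>' \<noteq> {}"
  then obtain \<tau> n m where t: "mono \<tau>" and n: "\<tau> n = \<mu>" "\<tau> (Suc n) = \<nu>"
    and m: "\<tau> m = \<mu>'" "\<tau> (Suc m) = \<nu>'"
    using Tab_mono by (auto simp: crossing_def)
  then have "n \<noteq> m" using assms(5) by auto
  \<comment> \<open>The target of the earlier crossing lies inside the source of the later one,
    which would then contain \<open>b\<close>.\<close>
  then have "\<nu> \<subseteq> \<mu>' \<or> \<nu>' \<subseteq> \<mu>"
    using monoD[OF t, of "Suc n" m] monoD[OF t, of "Suc m" n] n m by fastforce
  then show False using assms by blast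
qed

lemma Union_crossing:
  "(\<Union>\<mu> \<in> H' i j. crossing \<mu> (\<mu> \<union> {(i, j)})) = {\<tau> \<in> Tab. (i, j) \<in> (\<Union>n. \<tau> n)}"
proof (intro equalityI subsetI)
  fix \<tau> assume "\<tau> \<in> {\<tau> \<in> Tab. (i, j) \<in> (\<Union>n. \<tau> n)}"
  then have t: "\<tau> \<in> Tab" and "\<exists>n. (i, j) \<in> \<tau> n" by auto
  moreover from t have "(i, j) \<notin> \<tau> 0" by (simp add: Tab_def)
  \<comment> \<open>\<open>Suc n\<close> is the first time the box is present. It is positive
    because \<open>\<tau> 0\<close> is empty.\<close>
  ultimately obtain n where n: "(i, j) \<notin> \<tau> n" "(i, j) \<in> \<tau> (Suc n)"
    using ex_least_nat_less[of "\<lambda>n. (i, j) \<in> \<tau> n"] by blast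
  moreover have "\<tau> n \<nearrow> \<tau> (Suc n)" using t by (simp add: Tab_def)
  ultimately have "\<tau> (Suc n) = \<tau> n \<union> {(i, j)}" "\<tau> n \<in> H' i j"
    by (auto simp: young_edge_def H'_def)
  then show "\<tau> \<in> (\<Union>\<mu> \<in> H' i j. crossing \<mu> (\<mu> \<union> {(i, j)}))"
    using t by (auto simp: crossing_def)
qed (auto simp: crossing_def)

lemma countable_H': "countable (H' i j)"
proof (rule countable_subset)
  show "H' i j \<subseteq> {\<mu>. finite \<mu>}" by (auto simp: H'_def young_diagram_def)
qed (rule countable_Collect_finite)

text \<open>Countable additivity over an arbitrary countable index set, transported from sequences
  along the injection \<open>to_nat_on I\<close>.\<close>

lemma (in finite_measure) has_sum_measure_UN:
  assumes "countable I" "\<And>x. x \<in> I \<Longrightarrow> A x \<in> sets M" "disjoint_family_on A I"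
  shows "((\<lambda>x. measure M (A x)) has_sum measure M (\<Union>x \<in> I. A x)) I"
proof -
  let ?g = "to_nat_on I"
  define B where "B n = (\<Union>x \<in> {x \<in> I. ?g x = n}. A x)" for n
  have inj: "inj_on ?g I" using assms(1) by (rule inj_on_to_nat_on)
  have B: "B (?g x) = A x" if "x \<in> I" for x
    using that inj by (auto simp: B_def inj_on_def)
  have B_empty: "B n = {}" if "n \<notin> ?g ` I" for n
    using that by (auto simp: B_def)
  have "range B \<subseteq> sets M"
    unfolding B_def using assms(1,2)
    by (auto intro!: sets.countable_UN' intro: countable_subset)
  moreover have "disjoint_family B"
    using assms(3) by (fastforce simp: B_def disjoint_family_on_def)
  ultimately have "(\<lambda>n. measure M (B n)) sums measure M (\<Union>n. B n)"
    by (rule finite_measure_UNION)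
  moreover have "(\<Union>n. B n) = (\<Union>x \<in> I. A x)" by (auto simp: B_def)
  \<comment> \<open>Nonnegative terms turn convergence in order into unconditional summability,
    which allows restriction to the image and reindexing by \<open>I\<close>.\<close>
  ultimately have "((\<lambda>n. measure M (B n)) has_sum measure M (\<Union>x \<in> I. A x)) UNIV"
    by (simp add: sums_nonneg_imp_has_sum)
  then have "((\<lambda>n. measure M (B n)) has_sum measure M (\<Union>x \<in> I. A x)) (?g ` I)"
    by (rule has_sum_cong_neutral[THEN iffD1, rotated -1]) (simp_all add: B_empty)
  then have "((\<lambda>x. measure M (B (?g x))) has_sum measure M (\<Union>x \<in> I. A x)) I"
    by (simp only: has_sum_reindex[OF inj] o_def)
  then show ?thesis using B by (simp cong: has_sum_cong)
qed

theorem theorem1p8p1: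
  fixes \<kappa> :: "diagram \<Rightarrow> diagram \<Rightarrow> real"
    and M :: "(nat \<Rightarrow> diagram) measure"
    and \<phi> :: "diagram \<Rightarrow> real"
    and i j :: nat
  assumes "multiplicity_function \<kappa>"
    and "central_measure \<kappa> M"
    and "associated_harmonic \<kappa> M \<phi>"
    and "completely_reachable M (i, j)"
  shows "((\<lambda>\<mu>. kappa_dim \<kappa> \<mu> * \<kappa> \<mu> (\<mu> \<union> {(i, j)}) * \<phi> (\<mu> \<union> {(i, j)})) has_sum 1) (H' i j)"
proof -
  have prob: "prob_space M" and sets: "sets M = sets tab_borel"
    using assms(2) by (auto simp: central_measure_def)
  interpret prob_space M by fact
  let ?A = "\<lambda>\<mu>. crossing \<mu> (\<mu> \<union> {(i, j)})"
  have edge: "\<mu> \<nearrow> \<mu> \<union> {(i, j)}" if "\<mu> \<in> H' i j" for \<mu>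
    using that by (auto simp: H'_def young_edge_def)
  note meas = crossing_in_sets[OF prob sets assms(3) edge]
  have "disjoint_family_on ?A (H' i j)"
    unfolding disjoint_family_on_def
    by (intro ballI impI disjoint_crossing[where b = "(i, j)"]) (auto simp: H'_def)
  then have "((\<lambda>\<mu>. prob (?A \<mu>)) has_sum prob (\<Union>\<mu> \<in> H' i j. ?A \<mu>)) (H' i j)"
    using countable_H' meas by (intro has_sum_measure_UN)
  moreover have "space M = Tab"
    using sets_eq_imp_space_eq[OF sets] by (simp add: space_tab_borel)
  \<comment> \<open>By \<open>Union_crossing\<close>, complete reachability says exactly that almost
    every path makes one of the crossings.\<close>
  then have "AE \<tau> in M. \<tau> \<in> (\<Union>\<mu> \<in> H' i j. ?A \<mu>)"
    using assms(4) unfolding Union_crossing completely_reachable_def by auto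
  then have "prob (\<Union>\<mu> \<in> H' i j. ?A \<mu>) = 1"
    using meas countable_H' by (intro prob_eq_1[THEN iffD2] sets.countable_UN') auto
  ultimately have "((\<lambda>\<mu>. prob (?A \<mu>)) has_sum 1) (H' i j)" by (simp only:)
  then show ?thesis
    by (rule has_sum_cong[THEN iffD1, rotated])
      (rule measure_crossing[OF prob sets assms(3) edge])
qed

end
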